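(* The set $\mathcal F$ with the product defined in the context is a Moufang loop belonging to the variety $\mathcal E$.
   Context: In a Moufang loop, $[x,y]=x^{-1}y^{-1}xy$ and $(x,y,z)=((xy)z)(x(yz))^{-1}$. $\mathcal E$ is the variety of Moufang loops defined by the identities $x^4=1$, $[x,y]^2=1$, $(x,y,z)^2=1$, $[x^2,y]=1$, $[[x,y],t]=1$, $[(x,y,z),t]=1$, $(x^2,y,z)=1$, $([x,y],z,t)=1$, $((x,y,z),t,s)=1$. Construction of $\mathcal F$. Let $V$ be the $\mathbf F_2$-vector space of all finite subsets of $\mathbb N=\{1,2,\dots\}$, with addition the symmetric difference $\Delta$ (the basis vector with index $i$ is identified with $\{i\}$, also written $i$). Let $\bar V$, $W$, $U$ be elementary abelian $2$-groups, written multiplicatively, with bases respectively $\{\bar i : i\in\mathbb N\}$; the symbols $i\wedge j$ for unordered pairs $\{i,j\}$ with $i\ne j$; and the symbols $i\wedge j\wedge k$ for unordered triples of distinct $i,j,k$. The symbols are symmetric in their indices and are trivial (equal to $1$) if two indices coincide. As a set $\mathcal F=V\times(\bar V\times W\times U)$, with elements written $\sigma z$, $\sigma\in V$, $z\in \bar V\times W\times U$. For $\sigma,\mu\in V$, $$\sigma\cdot\mu=(\sigma\Delta\mu)\prod_{i\in\sigma\cap\mu}\bar i\ \prod_{i\in\sigma,\,j\in\mu,\,i>j} i\wedge j\ \prod_{i\in\sigma,\ j,k\in\mu,\ j<k} i\wedge j\wedge k ,$$ and $(\sigma z)\cdot(\mu z')=(\sigma\cdot\mu)\,z z'$ for $z,z'\in\bar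 V\times W\times U$. *)

theory Defs
  imports "HOL-Algebra.Group" "HOL-Algebra.FiniteProduct"
begin

text \<open>
  Loops reuse the record type of monoids from HOL-Algebra, without associativity.
\<close>

locale loop =
  fixes G (structure)
  assumes m_closed [intro, simp]:
      "\<lbrakk>x \<in> carrier G; y \<in> carrier G\<rbrakk> \<Longrightarrow> x \<otimes> y \<in> carrier G"
    and one_closed [intro, simp]: "\<one> \<in> carrier G"
    and l_one [simp]: "x \<in> carrier G \<Longrightarrow> \<one> \<otimes> x = x"
    and r_one [simp]: "x \<in> carrier G \<Longrightarrow> x \<otimes> \<one> = x"
    and left_division:
      "\<lbrakk>a \<in> carrier G; b \<in> carrier G\<rbrakk> \<Longrightarrow> \<exists>!x. x \<in> carrier G \<and> a \<otimes> x = b"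
    and right_division:
      "\<lbrakk>a \<in> carrier G; b \<in> carrier G\<rbrakk> \<Longrightarrow> \<exists>!y. y \<in> carrier G \<and> y \<otimes> a = b"

text \<open>
  The four customary Moufang identities are equivalent in a loop; one of them is used here.
\<close>

locale moufang_loop = loop +
  assumes moufang:
    "\<lbrakk>x \<in> carrier G; y \<in> carrier G; z \<in> carrier G\<rbrakk>
      \<Longrightarrow> (x \<otimes> y) \<otimes> (z \<otimes> x) = (x \<otimes> (y \<otimes> z)) \<otimes> x"

text \<open>
  In a Moufang loop every element has a unique two-sided inverse, which is what \<open>m_inv\<close>
  selects, and any two elements generate a subgroup. Hence the bracketing of powers and of
  the commutator is immaterial; powers and commutators below are left-normed.
\<close>

definition loop_commutator :: "('a, 'b) monoid_scheme \<Rightarrow> 'a \<Rightarrow> 'a \<Rightarrow> 'a" where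
  "loop_commutator G x y =
    ((inv\<^bsub>G\<^esub> x \<otimes>\<^bsub>G\<^esub> inv\<^bsub>G\<^esub> y) \<otimes>\<^bsub>G\<^esub> x) \<otimes>\<^bsub>G\<^esub> y"

definition loop_associator :: "('a, 'b) monoid_scheme \<Rightarrow> 'a \<Rightarrow> 'a \<Rightarrow> 'a \<Rightarrow> 'a" where
  "loop_associator G x y z =
    ((x \<otimes>\<^bsub>G\<^esub> y) \<otimes>\<^bsub>G\<^esub> z) \<otimes>\<^bsub>G\<^esub> inv\<^bsub>G\<^esub> (x \<otimes>\<^bsub>G\<^esub> (y \<otimes>\<^bsub>G\<^esub> z))"

locale variety_E = moufang_loop +
  assumes exponent_4: "x \<in> carrier G \<Longrightarrow> x [^] (4::nat) = \<one>"
    and commutator_sq: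
      "\<lbrakk>x \<in> carrier G; y \<in> carrier G\<rbrakk>
        \<Longrightarrow> (loop_commutator G x y) [^] (2::nat) = \<one>"
    and associator_sq:
      "\<lbrakk>x \<in> carrier G; y \<in> carrier G; z \<in> carrier G\<rbrakk>
        \<Longrightarrow> (loop_associator G x y z) [^] (2::nat) = \<one>"
    and commutator_of_sq:
      "\<lbrakk>x \<in> carrier G; y \<in> carrier G\<rbrakk>
        \<Longrightarrow> loop_commutator G (x [^] (2::nat)) y = \<one>"
    and commutator_of_commutator:
      "\<lbrakk>x \<in> carrier G; y \<in> carrier G; t \<in> carrier G\<rbrakk>
        \<Longrightarrow> loop_commutator G (loop_commutator G x y) t = \<one>"
    and commutator_of_associator:
      "\<lbrakk>x \<in> carrier G; y \<in> carrier G; z \<in> carrier G; t \<in> carrier G\<rbrakk>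
        \<Longrightarrow> loop_commutator G (loop_associator G x y z) t = \<one>"
    and associator_of_sq:
      "\<lbrakk>x \<in> carrier G; y \<in> carrier G; z \<in> carrier G\<rbrakk>
        \<Longrightarrow> loop_associator G (x [^] (2::nat)) y z = \<one>"
    and associator_of_commutator:
      "\<lbrakk>x \<in> carrier G; y \<in> carrier G; z \<in> carrier G; t \<in> carrier G\<rbrakk>
        \<Longrightarrow> loop_associator G (loop_commutator G x y) z t = \<one>"
    and associator_of_associator:
      "\<lbrakk>x \<in> carrier G; y \<in> carrier G; z \<in> carrier G; t \<in> carrier G; s \<in> carrier G\<rbrakk>
        \<Longrightarrow> loop_associator G (loop_associator G x y z) t s = \<one>"

text \<open>
  A set \<open>X\<close> in the carrier stands for the product of the basis elements belonging to \<open>X\<close>;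
  in particular the basis element \<open>b\<close> is represented by the singleton of \<open>b\<close>.
\<close>

definition elem_ab2 :: "'b set \<Rightarrow> 'b set monoid" where
  "elem_ab2 B = \<lparr>carrier = {X. finite X \<and> X \<subseteq> B}, mult = sym_diff, one = {}\<rparr>"

lemma elem_ab2_comm_group: "comm_group (elem_ab2 B)"
proof (rule comm_groupI)
  fix x assume "x \<in> carrier (elem_ab2 B)"
  then show "\<exists>y\<in>carrier (elem_ab2 B). y \<otimes>\<^bsub>elem_ab2 B\<^esub> x = \<one>\<^bsub>elem_ab2 B\<^esub>"
    by (intro bexI[of _ x]) (auto simp: elem_ab2_def)
qed (auto simp: elem_ab2_def)

lemma elem_ab2_sq: "x \<otimes>\<^bsub>elem_ab2 B\<^esub> x = \<one>\<^bsub>elem_ab2 B\<^esub>"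
  by (auto simp: elem_ab2_def)

text \<open>
  The singletons generate, and a product of distinct singletons determines its set of factors,
  so they form a basis.
\<close>

lemma elem_ab2_basis:
  assumes "finite X" "X \<subseteq> B"
  shows "finprod (elem_ab2 B) (\<lambda>b. {b}) X = X"
proof -
  interpret comm_group "elem_ab2 B" by (rule elem_ab2_comm_group)
  show ?thesis
    using assms
  proof (induction X rule: finite_induct)
    case empty
    have "finprod (elem_ab2 B) (\<lambda>b. {b}) {} = \<one>\<^bsub>elem_ab2 B\<^esub>"
      by (rule finprod_empty)
    then show ?case by (simp add: elem_ab2_def)
  next
    case (insert x X)
    have "finprod (elem_ab2 B) (\<lambda>b. {b}) (insert x X) = {x} \<otimes>\<^bsub>elem_ab2 B\<^esub> X"
      using insert by (subst finprod_insert) (auto simp: elem_ab2_def)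
    then show ?case
      using insert.hyps by (auto simp: elem_ab2_def)
  qed
qed

definition indices :: "nat set" where
  "indices = {1..}"

definition V :: "nat set monoid" where
  "V = elem_ab2 indices"

definition V_bar :: "nat set monoid" where
  "V_bar = elem_ab2 indices"

definition W :: "nat set set monoid" where
  "W = elem_ab2 {p. p \<subseteq> indices \<and> card p = 2}"

definition U :: "nat set set monoid" where
  "U = elem_ab2 {t. t \<subseteq> indices \<and> card t = 3}"

definition Z :: "(nat set \<times> nat set set \<times> nat set set) monoid" where
  "Z = V_bar \<times>\<times> (W \<times>\<times> U)"

definition bar :: "nat \<Rightarrow> nat set" where
  "bar i = {i}"

definition wedge2 :: "nat \<Rightarrow> nat \<Rightarrow> nat set set" where
  "wedge2 i j = (if distinct [i, j] then {{i, j}} else \<one>\<^bsub>W\<^esub>)"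

definition wedge3 :: "nat \<Rightarrow> nat \<Rightarrow> nat \<Rightarrow> nat set set" where
  "wedge3 i j k = (if distinct [i, j, k] then {{i, j, k}} else \<one>\<^bsub>U\<^esub>)"

text \<open>The factor of \<open>\<sigma> \<cdot> \<mu>\<close> that lies in \<open>Z\<close>.\<close>

definition central_factor ::
    "nat set \<Rightarrow> nat set \<Rightarrow> nat set \<times> nat set set \<times> nat set set" where
  "central_factor \<sigma> \<mu> =
    (finprod V_bar bar (\<sigma> \<inter> \<mu>),
     finprod W (\<lambda>(i, j). wedge2 i j) {(i, j). i \<in> \<sigma> \<and> j \<in> \<mu> \<and> i > j},
     finprod U (\<lambda>(i, j, k). wedge3 i j k)
       {(i, j, k). i \<in> \<sigma> \<and> j \<in> \<mu> \<and> k \<in> \<mu> \<and> j < k})"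

definition loop_F :: "(nat set \<times> (nat set \<times> nat set set \<times> nat set set)) monoid" where
  "loop_F =
    \<lparr>carrier = carrier V \<times> carrier Z,
     mult = (\<lambda>(\<sigma>, z) (\<mu>, z').
       (\<sigma> \<otimes>\<^bsub>V\<^esub> \<mu>, (central_factor \<sigma> \<mu> \<otimes>\<^bsub>Z\<^esub> z) \<otimes>\<^bsub>Z\<^esub> z')),
     one = (\<one>\<^bsub>V\<^esub>, \<one>\<^bsub>Z\<^esub>)\<rparr>"

end

(* F is a central extension of V by Z with factor f = central_factor.  The first two components of f
   are bilinear.  The third is linear in its first argument and quadratic in the second, and its
   polarisation T(x, y, z) is the sum of i \<and> j \<and> k over x \<times> y \<times> z, which is symmetric and alternating.
   The Moufang law for F reduces to T(x, z, x) + T(y, z, x) + T(x, y, z) = 0.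
   The remaining identities hold in every such extension: squares, commutators and associators lie
   in Z, which has exponent 2 and is contained in the centre and in the nucleus. *)
theory Submission
  imports Defs
begin

section \<open>Abelian groups of exponent 2\<close>

locale elementary_2_group = comm_group +
  assumes sq [simp]: "x \<in> carrier G \<Longrightarrow> x \<otimes> x = \<one>"
begin

lemma sq_left [simp]: "x \<in> carrier G \<Longrightarrow> y \<in> carrier G \<Longrightarrow> x \<otimes> (x \<otimes> y) = y"
  by (simp flip: m_assoc)

lemma sq_eq_iff:
  assumes "a \<in> carrier G" "x \<in> carrier G" "b \<in> carrier G"
  shows "a \<otimes> x = b \<longleftrightarrow> x = a \<otimes> b"
  using assms by auto

text \<open>The factors over \<open>A \<inter> B\<close> occur in both products on the right and
  cancel, since squares are trivial. Every additivity property of the cocycle is read off from its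
  index sets through this.\<close>

lemma finprod_sym_diff:
  assumes "finite A" "finite B" "g \<in> A \<union> B \<rightarrow> carrier G"
  shows "finprod G g (sym_diff A B) = finprod G g A \<otimes> finprod G g B"
proof -
  have g: "g \<in> A - B \<rightarrow> carrier G" "g \<in> B - A \<rightarrow> carrier G" "g \<in> A \<inter> B \<rightarrow> carrier G"
    using assms(3) by auto
  have A: "finprod G g A = finprod G g (A - B) \<otimes> finprod G g (A \<inter> B)"
    using finprod_Un_disjoint[of "A - B" "A \<inter> B" g] assms(1) g
    by (metis Diff_disjoint Int_Diff Int_commute Un_Diff_Int finite_Diff finite_Int)
  have B: "finprod G g B = finprod G g (B - A) \<otimes> finprod G g (A \<inter> B)"
    using finprod_Un_disjoint[of "B - A" "A \<inter> B" g] assms(2) g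
    by (metis Diff_disjoint Int_Diff Int_commute Un_Diff_Int finite_Diff finite_Int)
  have "finprod G g (sym_diff A B) = finprod G g (A - B) \<otimes> finprod G g (B - A)"
    using assms(1,2) g by (intro finprod_Un_disjoint) auto
  then show ?thesis
    using g by (simp add: A B m_ac)
qed

end

lemma elem_ab2_elementary: "elementary_2_group (elem_ab2 B)"
  by (intro elementary_2_group.intro elem_ab2_comm_group elementary_2_group_axioms.intro elem_ab2_sq)

lemma DirProd_elementary:
  assumes "elementary_2_group G" "elementary_2_group H"
  shows "elementary_2_group (G \<times>\<times> H)"
proof -
  interpret G: elementary_2_group G by fact
  interpret H: elementary_2_group H by fact
  show ?thesis
  proof (intro elementary_2_group.intro elementary_2_group_axioms.intro comm_groupI)
    fix x assume "x \<in> carrier (G \<times>\<times> H)"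
    then show "\<exists>y\<in>carrier (G \<times>\<times> H). y \<otimes>\<^bsub>G \<times>\<times> H\<^esub> x = \<one>\<^bsub>G \<times>\<times> H\<^esub>"
      by (intro bexI[of _ x]) (auto simp: DirProd_def)
  qed (auto simp: DirProd_def G.m_ac H.m_ac)
qed

section \<open>Central extensions given by a Moufang cocycle\<close>

definition central_extension ::
  "('a, 'c) monoid_scheme \<Rightarrow> ('b, 'd) monoid_scheme \<Rightarrow> ('a \<Rightarrow> 'a \<Rightarrow> 'b) \<Rightarrow> ('a \<times> 'b) monoid" where
  "central_extension Q K f =
    \<lparr>carrier = carrier Q \<times> carrier K,
     mult = (\<lambda>(\<sigma>, z) (\<mu>, z'). (\<sigma> \<otimes>\<^bsub>Q\<^esub> \<mu>, (f \<sigma> \<mu> \<otimes>\<^bsub>K\<^esub> z) \<otimes>\<^bsub>K\<^esub> z')),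
     one = (\<one>\<^bsub>Q\<^esub>, \<one>\<^bsub>K\<^esub>)\<rparr>"

text \<open>Normalisation of \<open>f\<close> makes the pair of units the unit of the extension.
  \<open>f_moufang\<close> is what remains of the Moufang identity after the \<open>K\<close>
  components of the three elements are cancelled; on the \<open>Q\<close> components the identity
  holds because \<open>Q\<close> is an abelian group.\<close>

locale moufang_cocycle = Q: elementary_2_group Q + K: elementary_2_group K
  for Q (structure) and K (structure) +
  fixes f
  assumes f_closed [simp]:
      "\<lbrakk>x \<in> carrier Q; y \<in> carrier Q\<rbrakk> \<Longrightarrow> f x y \<in> carrier K"
    and f_one_left [simp]: "x \<in> carrier Q \<Longrightarrow> f \<one>\<^bsub>Q\<^esub> x = \<one>\<^bsub>K\<^esub>"
    and f_one_right [simp]: "x \<in> carrier Q \<Longrightarrow> f x \<one>\<^bsub>Q\<^esub> = \<one>\<^bsub>K\<^esub>"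
    and f_moufang:
      "\<lbrakk>x \<in> carrier Q; y \<in> carrier Q; z \<in> carrier Q\<rbrakk> \<Longrightarrow>
        (f x y \<otimes>\<^bsub>K\<^esub> f z x) \<otimes>\<^bsub>K\<^esub> f (x \<otimes>\<^bsub>Q\<^esub> y) (z \<otimes>\<^bsub>Q\<^esub> x) =
        (f y z \<otimes>\<^bsub>K\<^esub> f x (y \<otimes>\<^bsub>Q\<^esub> z)) \<otimes>\<^bsub>K\<^esub> f (x \<otimes>\<^bsub>Q\<^esub> (y \<otimes>\<^bsub>Q\<^esub> z)) x"
begin

abbreviation E where "E \<equiv> central_extension Q K f"

lemma carrier_E [simp]: "carrier E = carrier Q \<times> carrier K"
  and mult_E [simp]:
    "(\<sigma>, z) \<otimes>\<^bsub>E\<^esub> (\<mu>, z') = (\<sigma> \<otimes>\<^bsub>Q\<^esub> \<mu>, (f \<sigma> \<mu> \<otimes>\<^bsub>K\<^esub> z) \<otimes>\<^bsub>K\<^esub> z')"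
  and one_E [simp]: "\<one>\<^bsub>E\<^esub> = (\<one>\<^bsub>Q\<^esub>, \<one>\<^bsub>K\<^esub>)"
  by (simp_all add: central_extension_def)

lemma loop_E: "loop E"
proof
  fix a b assume "a \<in> carrier E" "b \<in> carrier E"
  then obtain \<sigma> z \<mu> w where ab: "a = (\<sigma>, z)" "b = (\<mu>, w)"
    and [simp]: "\<sigma> \<in> carrier Q" "\<mu> \<in> carrier Q" "z \<in> carrier K" "w \<in> carrier K"
    by auto
  show "\<exists>!x. x \<in> carrier E \<and> a \<otimes>\<^bsub>E\<^esub> x = b"
    \<comment> \<open>As \<sigma> is its own inverse, the first component of the quotient must be
      the product of \<sigma> and \<mu>; the second then solves a linear equation in
      \<open>K\<close>.\<close>
    by (rule ex1I[of _ "(\<sigma> \<otimes>\<^bsub>Q\<^esub> \<mu>, (f \<sigma> (\<sigma> \<otimes>\<^bsub>Q\<^esub> \<mu>) \<otimes>\<^bsub>K\<^esub> z) \<otimes>\<^bsub>K\<^esub> w)"])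
      (auto simp: ab Q.m_ac K.m_ac)
  show "\<exists>!x. x \<in> carrier E \<and> x \<otimes>\<^bsub>E\<^esub> a = b"
    by (rule ex1I[of _ "(\<sigma> \<otimes>\<^bsub>Q\<^esub> \<mu>, (f (\<sigma> \<otimes>\<^bsub>Q\<^esub> \<mu>) \<sigma> \<otimes>\<^bsub>K\<^esub> z) \<otimes>\<^bsub>K\<^esub> w)"])
      (auto simp: ab Q.m_ac K.m_ac)
qed auto

lemma moufang_loop_E: "moufang_loop E"
proof (intro moufang_loop.intro loop_E moufang_loop_axioms.intro)
  fix x y z assume "x \<in> carrier E" "y \<in> carrier E" "z \<in> carrier E"
  then obtain a b c x' y' z' where xyz: "x = (a, x')" "y = (b, y')" "z = (c, z')"
    and [simp]: "a \<in> carrier Q" "b \<in> carrier Q" "c \<in> carrier Q"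
      "x' \<in> carrier K" "y' \<in> carrier K" "z' \<in> carrier K"
    by auto
  \<comment> \<open>Both sides of the Moufang identity contain \<open>x'\<close> twice, so it
    cancels, and \<open>y'\<close>, \<open>z'\<close> are all that accompanies the values of
    \<open>f\<close>.\<close>
  have "((f a b \<otimes>\<^bsub>K\<^esub> f c a) \<otimes>\<^bsub>K\<^esub> f (a \<otimes>\<^bsub>Q\<^esub> b) (c \<otimes>\<^bsub>Q\<^esub> a)) \<otimes>\<^bsub>K\<^esub> (y' \<otimes>\<^bsub>K\<^esub> z') =
    ((f b c \<otimes>\<^bsub>K\<^esub> f a (b \<otimes>\<^bsub>Q\<^esub> c)) \<otimes>\<^bsub>K\<^esub> f (a \<otimes>\<^bsub>Q\<^esub> (b \<otimes>\<^bsub>Q\<^esub> c)) a) \<otimes>\<^bsub>K\<^esub> (y' \<otimes>\<^bsub>K\<^esub> z')"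
    by (simp only: f_moufang \<open>a \<in> _\<close> \<open>b \<in> _\<close> \<open>c \<in> _\<close>)
  then show "(x \<otimes>\<^bsub>E\<^esub> y) \<otimes>\<^bsub>E\<^esub> (z \<otimes>\<^bsub>E\<^esub> x) = (x \<otimes>\<^bsub>E\<^esub> (y \<otimes>\<^bsub>E\<^esub> z)) \<otimes>\<^bsub>E\<^esub> x"
    by (simp add: xyz Q.m_ac K.m_ac)
qed

text \<open>The first component is its own inverse in \<open>Q\<close>. Multiplying by (\<sigma>, w)
  on either side gives \<open>f \<sigma> \<sigma>\<close> times z and w in \<open>K\<close>, which
  forces w.\<close>

lemma inv_E [simp]:
  assumes "\<sigma> \<in> carrier Q" "z \<in> carrier K"
  shows "inv\<^bsub>E\<^esub> (\<sigma>, z) = (\<sigma>, f \<sigma> \<sigma> \<otimes>\<^bsub>K\<^esub> z)"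
  unfolding m_inv_def
  by (rule the_equality) (use assms in \<open>auto simp: K.m_ac K.sq_eq_iff Q.sq_eq_iff\<close>)

lemma square_E:
  assumes "\<sigma> \<in> carrier Q" "z \<in> carrier K"
  shows "(\<sigma>, z) [^]\<^bsub>E\<^esub> (2::nat) = (\<one>\<^bsub>Q\<^esub>, f \<sigma> \<sigma>)"
  using assms by (simp add: nat_pow_def numeral_2_eq_2 K.m_ac)

text \<open>Projection to \<open>Q\<close> is a homomorphism, and \<open>Q\<close> is commutative,
  so commutators fall into its kernel. For associators the same follows from associativity of
  \<open>Q\<close>.\<close>

lemma commutator_E_central:
  assumes "x \<in> carrier E" "y \<in> carrier E"
  obtains w where "w \<in> carrier K" "loop_commutator E x y = (\<one>\<^bsub>Q\<^esub>, w)"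
  using assms by (force simp: loop_commutator_def Q.m_ac)

lemma associator_E_central:
  assumes "x \<in> carrier E" "y \<in> carrier E" "z \<in> carrier E"
  obtains w where "w \<in> carrier K" "loop_associator E x y z = (\<one>\<^bsub>Q\<^esub>, w)"
  using assms by (force simp: loop_associator_def Q.m_ac)

text \<open>Since \<open>f\<close> is trivial when either argument is the unit, multiplication by
  such an element, on either side, only multiplies the second component by w. The nucleus statement
  below rests on the same fact.\<close>

lemma commutator_E_centre:
  assumes "w \<in> carrier K" "y \<in> carrier E"
  shows "loop_commutator E (\<one>\<^bsub>Q\<^esub>, w) y = \<one>\<^bsub>E\<^esub>"
  using assms by (auto simp: loop_commutator_def K.m_ac)

lemma associator_E_nucleus:
  assumes "w \<in> carrier K" "y \<in> carrier E" "z \<in> carrier E"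
  shows "loop_associator E (\<one>\<^bsub>Q\<^esub>, w) y z = \<one>\<^bsub>E\<^esub>"
  using assms by (auto simp: loop_associator_def K.m_ac Q.m_ac)

lemma variety_E_E: "variety_E E"
proof (intro variety_E.intro moufang_loop_E variety_E_axioms.intro)
  fix x y z t s
  assume x: "x \<in> carrier E"
  \<comment> \<open>In the left-normed fourth power, the value of \<open>f\<close> on the repeated
    first component occurs twice and the second component four times, so everything cancels.\<close>
  then show "x [^]\<^bsub>E\<^esub> (4::nat) = \<one>\<^bsub>E\<^esub>"
    by (auto simp: nat_pow_def eval_nat_numeral K.m_ac)
  \<comment> \<open>Squares, commutators and associators are each rewritten as a pair with trivial
    first component. Every remaining identity squares such a pair or puts it into the first slot of
    a commutator or associator.\<close>
  obtain q where q: "q \<in> carrier K" "x [^]\<^bsub>E\<^esub> (2::nat) = (\<one>\<^bsub>Q\<^esub>, q)"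
    using x square_E f_closed by (cases x) force
  assume y: "y \<in> carrier E"
  show "loop_commutator E (x [^]\<^bsub>E\<^esub> (2::nat)) y = \<one>\<^bsub>E\<^esub>"
    using commutator_E_centre q y by simp
  obtain w where w: "w \<in> carrier K" "loop_commutator E x y = (\<one>\<^bsub>Q\<^esub>, w)"
    using commutator_E_central x y .
  show "loop_commutator E x y [^]\<^bsub>E\<^esub> (2::nat) = \<one>\<^bsub>E\<^esub>"
    using w by (simp add: square_E)
  show "loop_commutator E (loop_commutator E x y) t = \<one>\<^bsub>E\<^esub>" if "t \<in> carrier E"
    using that w commutator_E_centre by simp
  assume z: "z \<in> carrier E"
  show "loop_associator E (x [^]\<^bsub>E\<^esub> (2::nat)) y z = \<one>\<^bsub>E\<^esub>"
    using associator_E_nucleus q y z by simp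
  obtain v where v: "v \<in> carrier K" "loop_associator E x y z = (\<one>\<^bsub>Q\<^esub>, v)"
    using associator_E_central x y z .
  show "loop_associator E x y z [^]\<^bsub>E\<^esub> (2::nat) = \<one>\<^bsub>E\<^esub>"
    using v by (simp add: square_E)
  assume t: "t \<in> carrier E"
  show "loop_commutator E (loop_associator E x y z) t = \<one>\<^bsub>E\<^esub>"
    using v t commutator_E_centre by simp
  show "loop_associator E (loop_commutator E x y) z t = \<one>\<^bsub>E\<^esub>"
    using w z t associator_E_nucleus by simp
  show "loop_associator E (loop_associator E x y z) t s = \<one>\<^bsub>E\<^esub>" if "s \<in> carrier E"
    using that v t associator_E_nucleus by simp
qed

end

section \<open>Criteria for Moufang cocycles\<close>

lemma moufang_cocycle_DirProd:
  assumes "moufang_cocycle Q G f" "moufang_cocycle Q H g"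
  shows "moufang_cocycle Q (G \<times>\<times> H) (\<lambda>x y. (f x y, g x y))"
proof -
  interpret F: moufang_cocycle Q G f by fact
  interpret G: moufang_cocycle Q H g by fact
  show ?thesis
    by (intro moufang_cocycle.intro moufang_cocycle_axioms.intro DirProd_elementary
        F.Q.elementary_2_group_axioms F.K.elementary_2_group_axioms G.K.elementary_2_group_axioms)
      (auto simp: F.f_moufang G.f_moufang)
qed

text \<open>After expansion, the two sides of the Moufang condition differ by
  \<open>T x z x\<close>, \<open>T y z x\<close> and \<open>T x y z\<close>. The first is trivial by
  \<open>alternating\<close>; the other two coincide by \<open>cyclic\<close> and cancel in exponent
  2.\<close>

lemma moufang_cocycle_quadratic:
  fixes Q (structure) and K (structure)
  assumes "elementary_2_group Q" "elementary_2_group K"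
    and closed: "\<And>x y. \<lbrakk>x \<in> carrier Q; y \<in> carrier Q\<rbrakk> \<Longrightarrow> f x y \<in> carrier K"
    and one_right: "\<And>x. x \<in> carrier Q \<Longrightarrow> f x \<one>\<^bsub>Q\<^esub> = \<one>\<^bsub>K\<^esub>"
    and T_closed: "\<And>x y z. \<lbrakk>x \<in> carrier Q; y \<in> carrier Q; z \<in> carrier Q\<rbrakk> \<Longrightarrow> T x y z \<in> carrier K"
    and left: "\<And>x x' y. \<lbrakk>x \<in> carrier Q; x' \<in> carrier Q; y \<in> carrier Q\<rbrakk> \<Longrightarrow>
      f (x \<otimes>\<^bsub>Q\<^esub> x') y = f x y \<otimes>\<^bsub>K\<^esub> f x' y"
    and right: "\<And>x y z. \<lbrakk>x \<in> carrier Q; y \<in> carrier Q; z \<in> carrier Q\<rbrakk> \<Longrightarrow>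
      f x (y \<otimes>\<^bsub>Q\<^esub> z) = (f x y \<otimes>\<^bsub>K\<^esub> f x z) \<otimes>\<^bsub>K\<^esub> T x y z"
    and alternating: "\<And>x z. \<lbrakk>x \<in> carrier Q; z \<in> carrier Q\<rbrakk> \<Longrightarrow> T x z x = \<one>\<^bsub>K\<^esub>"
    and cyclic: "\<And>x y z. \<lbrakk>x \<in> carrier Q; y \<in> carrier Q; z \<in> carrier Q\<rbrakk> \<Longrightarrow> T y z x = T x y z"
  shows "moufang_cocycle Q K f"
proof -
  interpret Q: elementary_2_group Q by fact
  interpret K: elementary_2_group K by fact
  show ?thesis
  proof
    fix x assume x: "x \<in> carrier Q"
    \<comment> \<open>Splitting the unit as a product of two units equates this value with its own
      square, which is trivial.\<close>
    show "f \<one>\<^bsub>Q\<^esub> x = \<one>\<^bsub>K\<^esub>"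
      using left[of "\<one>\<^bsub>Q\<^esub>" "\<one>\<^bsub>Q\<^esub>" x] x by (simp add: closed)
    fix y z assume y: "y \<in> carrier Q" and z: "z \<in> carrier Q"
    have *: "T y z x = T x y z"
      using cyclic x y z by blast
    show "(f x y \<otimes>\<^bsub>K\<^esub> f z x) \<otimes>\<^bsub>K\<^esub> f (x \<otimes>\<^bsub>Q\<^esub> y) (z \<otimes>\<^bsub>Q\<^esub> x) =
        (f y z \<otimes>\<^bsub>K\<^esub> f x (y \<otimes>\<^bsub>Q\<^esub> z)) \<otimes>\<^bsub>K\<^esub> f (x \<otimes>\<^bsub>Q\<^esub> (y \<otimes>\<^bsub>Q\<^esub> z)) x"
      \<comment> \<open>First arguments have to be split before second ones: applying
        \<open>right\<close> to a product in the first slot would create a value of \<open>T\<close>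
        at that product, and additivity of \<open>T\<close> is not among the assumptions.\<close>
      unfolding left[OF x y Q.m_closed[OF z x]] left[OF x Q.m_closed[OF y z] x]
      using x y z by (simp add: left[OF y z x] right alternating * closed T_closed K.m_ac)
  qed (simp_all add: closed one_right)
qed

section \<open>The concrete groups and the two bilinear components\<close>

lemma V_elementary: "elementary_2_group V"
  and W_elementary: "elementary_2_group W"
  and U_elementary: "elementary_2_group U"
  and V_bar_elementary: "elementary_2_group V_bar"
  by (simp_all add: V_def W_def U_def V_bar_def elem_ab2_elementary)

interpretation V: elementary_2_group V by (rule V_elementary)
interpretation V_bar: elementary_2_group V_bar by (rule V_bar_elementary)
interpretation W: elementary_2_group W by (rule W_elementary)
interpretation U: elementary_2_group U by (rule U_elementary)

lemma carrier_V: "x \<in> carrier V \<longleftrightarrow> finite x \<and> x \<subseteq> indices"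
  and mult_V: "x \<otimes>\<^bsub>V\<^esub> y = sym_diff x y"
  and one_V: "\<one>\<^bsub>V\<^esub> = {}"
  by (simp_all add: V_def elem_ab2_def)

lemma bar_closed: "i \<in> indices \<Longrightarrow> bar i \<in> carrier V_bar"
  by (simp add: bar_def V_bar_def elem_ab2_def)

lemma wedge2_closed: "\<lbrakk>i \<in> indices; j \<in> indices\<rbrakk> \<Longrightarrow> wedge2 i j \<in> carrier W"
  by (simp add: wedge2_def W_def elem_ab2_def)

lemma wedge3_closed: "\<lbrakk>i \<in> indices; j \<in> indices; k \<in> indices\<rbrakk> \<Longrightarrow> wedge3 i j k \<in> carrier U"
  by (auto simp: wedge3_def U_def elem_ab2_def)

lemma wedge3_swap: "wedge3 i j k = wedge3 i k j"
  and wedge3_rotate: "wedge3 i j k = wedge3 j k i"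
  and wedge3_eq [simp]: "wedge3 i j j = \<one>\<^bsub>U\<^esub>"
  by (auto simp: wedge3_def insert_commute)

text \<open>An index set additive in both arguments makes the product bilinear, which is the
  quadratic criterion with trivial \<open>T\<close>. The components in \<open>V_bar\<close> and
  \<open>W\<close> are both of this kind.\<close>

lemma moufang_cocycle_bilinear_finprod:
  fixes H (structure)
  assumes "elementary_2_group H"
    and fin: "\<And>x y. \<lbrakk>finite x; finite y\<rbrakk> \<Longrightarrow> finite (R x y)"
    and g: "\<And>x y. \<lbrakk>x \<in> carrier V; y \<in> carrier V\<rbrakk> \<Longrightarrow> g \<in> R x y \<rightarrow> carrier H"
    and right_empty: "\<And>x. R x {} = {}"
    and left: "\<And>x x' y. R (sym_diff x x') y = sym_diff (R x y) (R x' y)"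
    and right: "\<And>x y z. R x (sym_diff y z) = sym_diff (R x y) (R x z)"
  shows "moufang_cocycle V H (\<lambda>x y. finprod H g (R x y))"
proof -
  interpret H: elementary_2_group H by fact
  have fin': "finite (R x y)" if "x \<in> carrier V" "y \<in> carrier V" for x y
    using that fin by (simp add: carrier_V)
  show ?thesis
  proof (rule moufang_cocycle_quadratic[where T = "\<lambda>_ _ _. \<one>\<^bsub>H\<^esub>"])
    fix x x' y
    assume "x \<in> carrier V" "x' \<in> carrier V" "y \<in> carrier V"
    moreover from this have "g \<in> R x y \<union> R x' y \<rightarrow> carrier H"
      using g by blast
    ultimately show "finprod H g (R (x \<otimes>\<^bsub>V\<^esub> x') y) = finprod H g (R x y) \<otimes>\<^bsub>H\<^esub> finprod H g (R x' y)"
      unfolding mult_V left using fin' by (intro H.finprod_sym_diff)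
  next
    fix x y z
    assume *: "x \<in> carrier V" "y \<in> carrier V" "z \<in> carrier V"
    then have "g \<in> R x y \<union> R x z \<rightarrow> carrier H"
      using g by blast
    then have "finprod H g (R x (y \<otimes>\<^bsub>V\<^esub> z)) = finprod H g (R x y) \<otimes>\<^bsub>H\<^esub> finprod H g (R x z)"
      unfolding mult_V right using fin' * by (intro H.finprod_sym_diff)
    then show "finprod H g (R x (y \<otimes>\<^bsub>V\<^esub> z)) =
        (finprod H g (R x y) \<otimes>\<^bsub>H\<^esub> finprod H g (R x z)) \<otimes>\<^bsub>H\<^esub> \<one>\<^bsub>H\<^esub>"
      using * g by simp
  qed (use g in \<open>simp_all add: V_elementary assms(1) one_V right_empty\<close>)
qed

lemma moufang_cocycle_bar: "moufang_cocycle V V_bar (\<lambda>x y. finprod V_bar bar (x \<inter> y))"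
  by (rule moufang_cocycle_bilinear_finprod)
    (auto simp: V_bar_elementary carrier_V intro!: bar_closed)

lemma moufang_cocycle_wedge2:
  "moufang_cocycle V W (\<lambda>x y. finprod W (\<lambda>(i, j). wedge2 i j) {(i, j). i \<in> x \<and> j \<in> y \<and> i > j})"
proof (rule moufang_cocycle_bilinear_finprod)
  fix x y :: "nat set" assume "finite x" "finite y"
  then show "finite {(i, j). i \<in> x \<and> j \<in> y \<and> i > j}"
    by (auto intro: finite_subset[of _ "x \<times> y"])
qed (auto simp: W_elementary carrier_V intro!: wedge2_closed)

section \<open>The component in \<open>U\<close> and its polarisation\<close>

definition triples :: "nat set \<Rightarrow> nat set \<Rightarrow> nat set \<Rightarrow> (nat \<times> nat \<times> nat) set" where
  "triples x y z = {(i, j, k). i \<in> x \<and> j \<in> y \<and> k \<in> z \<and> j < k}"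

abbreviation prod_wedge3 :: "(nat \<times> nat \<times> nat) set \<Rightarrow> nat set set" where
  "prod_wedge3 \<equiv> finprod U (\<lambda>(i, j, k). wedge3 i j k)"

lemma finite_triples: "\<lbrakk>finite x; finite y; finite z\<rbrakk> \<Longrightarrow> finite (triples x y z)"
  by (rule finite_subset[of _ "x \<times> y \<times> z"]) (auto simp: triples_def)

lemma wedge3_funcset:
  "A \<subseteq> indices \<times> indices \<times> indices \<Longrightarrow> (\<lambda>(i, j, k). wedge3 i j k) \<in> A \<rightarrow> carrier U"
  by (fastforce intro!: wedge3_closed)

text \<open>Meant for maps \<open>p\<close> that permute the three positions, under which the
  symmetric symbols do not change.\<close>

lemma prod_wedge3_image:
  assumes "A \<subseteq> indices \<times> indices \<times> indices" "inj_on p A"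
    and "\<And>t. t \<in> A \<Longrightarrow> (\<lambda>(i, j, k). wedge3 i j k) (p t) = (\<lambda>(i, j, k). wedge3 i j k) t"
  shows "prod_wedge3 (p ` A) = prod_wedge3 A"
proof -
  let ?w = "\<lambda>(i, j, k). wedge3 i j k"
  have w: "?w \<in> A \<rightarrow> carrier U"
    using assms(1) by (rule wedge3_funcset)
  then have "?w \<in> p ` A \<rightarrow> carrier U"
    using assms(3) by (simp add: Pi_iff)
  then have "prod_wedge3 (p ` A) = finprod U (\<lambda>t. ?w (p t)) A"
    using assms(2) by (rule U.finprod_reindex)
  also have "\<dots> = prod_wedge3 A"
    using w assms(3) by (intro U.finprod_cong') simp_all
  finally show ?thesis .
qed

text \<open>The box splits according to j < k, j > k and j = k. The last part contributes only
  trivial symbols, and the middle one becomes \<open>triples x z y\<close> on exchanging the last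
  two positions. The right-hand side is the pair of cross terms in the polarisation of the
  \<open>U\<close> component.\<close>

lemma prod_wedge3_Times:
  assumes "x \<in> carrier V" "y \<in> carrier V" "z \<in> carrier V"
  shows "prod_wedge3 (x \<times> y \<times> z) = prod_wedge3 (triples x y z) \<otimes>\<^bsub>U\<^esub> prod_wedge3 (triples x z y)"
proof -
  let ?w = "\<lambda>(i, j, k). wedge3 i j k"
  let ?G = "{(i, j, k). i \<in> x \<and> j \<in> y \<and> k \<in> z \<and> k < j}"
  have fin: "finite (triples x y z)" "finite ?G" "finite (x \<times> y \<times> z)"
    using assms by (auto simp: carrier_V finite_triples intro: finite_subset[of _ "x \<times> y \<times> z"])
  have sub: "triples x y z \<subseteq> indices \<times> indices \<times> indices" "?G \<subseteq> indices \<times> indices \<times> indices"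
    "x \<times> y \<times> z \<subseteq> indices \<times> indices \<times> indices" "triples x z y \<subseteq> indices \<times> indices \<times> indices"
    using assms by (auto simp: carrier_V triples_def)
  note w = sub[THEN wedge3_funcset]
  have G: "?G = (\<lambda>(i, j, k). (i, k, j)) ` triples x z y"
    by (force simp: triples_def)
  have inj: "inj_on (\<lambda>(i, j, k). (i, k, j)) (triples x z y)"
    by (auto simp: inj_on_def)
  have "prod_wedge3 ?G = prod_wedge3 (triples x z y)"
    unfolding G using sub(4) inj by (rule prod_wedge3_image) (auto simp: wedge3_swap)
  moreover have "prod_wedge3 (triples x y z \<union> ?G) =
      prod_wedge3 (triples x y z) \<otimes>\<^bsub>U\<^esub> prod_wedge3 ?G"
    using fin w by (intro U.finprod_Un_disjoint) (auto simp: triples_def)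
  moreover have "?w t = \<one>\<^bsub>U\<^esub>" if "t \<in> x \<times> y \<times> z - (triples x y z \<union> ?G)" for t
  proof -
    obtain i j k where t: "t = (i, j, k)" by (cases t)
    then have "j = k"
      using that by (auto simp: triples_def)
    then show ?thesis by (simp add: t)
  qed
  then have "prod_wedge3 (x \<times> y \<times> z) = prod_wedge3 (triples x y z \<union> ?G)"
    using fin(3) w(3)
    by (intro U.finprod_mono_neutral_cong_right) (simp_all, auto simp: triples_def)
  ultimately show ?thesis by simp
qed

lemma prod_wedge3_rotate:
  assumes "x \<in> carrier V" "y \<in> carrier V" "z \<in> carrier V"
  shows "prod_wedge3 (y \<times> z \<times> x) = prod_wedge3 (x \<times> y \<times> z)"
proof -
  have inj: "inj_on (\<lambda>(i, j, k). (j, k, i)) (x \<times> y \<times> z)"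
    by (auto simp: inj_on_def)
  have eq: "y \<times> z \<times> x = (\<lambda>(i, j, k). (j, k, i)) ` (x \<times> y \<times> z)"
    by force
  have sub: "x \<times> y \<times> z \<subseteq> indices \<times> indices \<times> indices"
    using assms by (auto simp: carrier_V)
  show ?thesis
    unfolding eq using sub inj by (rule prod_wedge3_image) (auto simp: wedge3_rotate[symmetric])
qed

lemma moufang_cocycle_wedge3:
  "moufang_cocycle V U (\<lambda>x y. prod_wedge3 {(i, j, k). i \<in> x \<and> j \<in> y \<and> k \<in> y \<and> j < k})"
proof -
  have closed: "prod_wedge3 (triples x y z) \<in> carrier U"
    if "x \<in> carrier V" "y \<in> carrier V" "z \<in> carrier V" for x y z
    using that by (intro U.finprod_closed wedge3_funcset) (auto simp: carrier_V triples_def)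
  have T_closed: "prod_wedge3 (x \<times> y \<times> z) \<in> carrier U"
    if "x \<in> carrier V" "y \<in> carrier V" "z \<in> carrier V" for x y z
    using that by (intro U.finprod_closed wedge3_funcset) (auto simp: carrier_V)
  have add: "prod_wedge3 (sym_diff A B) = prod_wedge3 A \<otimes>\<^bsub>U\<^esub> prod_wedge3 B"
    if "finite A" "finite B" "A \<union> B \<subseteq> indices \<times> indices \<times> indices" for A B
    using that by (intro U.finprod_sym_diff wedge3_funcset)
  have sub: "triples x y z \<subseteq> indices \<times> indices \<times> indices" "finite (triples x y z)"
    if "x \<in> carrier V" "y \<in> carrier V" "z \<in> carrier V" for x y z
    using that by (auto simp: carrier_V finite_triples) (auto simp: triples_def)
  \<comment> \<open>Because the last two slots of \<open>triples\<close> are independent, the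
    product is additive in each of the three slots; they are set equal only for the cocycle
    itself.\<close>
  have left: "prod_wedge3 (triples (x \<otimes>\<^bsub>V\<^esub> x') y z) =
      prod_wedge3 (triples x y z) \<otimes>\<^bsub>U\<^esub> prod_wedge3 (triples x' y z)"
    if "x \<in> carrier V" "x' \<in> carrier V" "y \<in> carrier V" "z \<in> carrier V" for x x' y z
  proof -
    have "triples (x \<otimes>\<^bsub>V\<^esub> x') y z = sym_diff (triples x y z) (triples x' y z)"
      by (auto simp: triples_def mult_V)
    then show ?thesis using that sub by (simp add: add)
  qed
  have mid: "prod_wedge3 (triples x (y \<otimes>\<^bsub>V\<^esub> y') z) =
      prod_wedge3 (triples x y z) \<otimes>\<^bsub>U\<^esub> prod_wedge3 (triples x y' z)"
    if "x \<in> carrier V" "y \<in> carrier V" "y' \<in> carrier V" "z \<in> carrier V" for x y y' z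
  proof -
    have "triples x (y \<otimes>\<^bsub>V\<^esub> y') z = sym_diff (triples x y z) (triples x y' z)"
      by (auto simp: triples_def mult_V)
    then show ?thesis using that sub by (simp add: add)
  qed
  have right: "prod_wedge3 (triples x y (z \<otimes>\<^bsub>V\<^esub> z')) =
      prod_wedge3 (triples x y z) \<otimes>\<^bsub>U\<^esub> prod_wedge3 (triples x y z')"
    if "x \<in> carrier V" "y \<in> carrier V" "z \<in> carrier V" "z' \<in> carrier V" for x y z z'
  proof -
    have "triples x y (z \<otimes>\<^bsub>V\<^esub> z') = sym_diff (triples x y z) (triples x y z')"
      by (auto simp: triples_def mult_V)
    then show ?thesis using that sub by (simp add: add)
  qed
  \<comment> \<open>Rotation moves the repeated set into the last two positions, where the box is
    the product of two equal factors.\<close>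
  have alternating: "prod_wedge3 (x \<times> z \<times> x) = \<one>\<^bsub>U\<^esub>" if "x \<in> carrier V" "z \<in> carrier V" for x z
    using prod_wedge3_rotate[OF that(2,1,1)] prod_wedge3_rotate[OF that(1,2,1)]
      prod_wedge3_Times[OF that(2,1,1)] that closed by simp
  have "moufang_cocycle V U (\<lambda>x y. prod_wedge3 (triples x y y))"
  proof (rule moufang_cocycle_quadratic[where T = "\<lambda>x y z. prod_wedge3 (x \<times> y \<times> z)"])
    fix x y z assume xyz: "x \<in> carrier V" "y \<in> carrier V" "z \<in> carrier V"
    show "prod_wedge3 (triples x (y \<otimes>\<^bsub>V\<^esub> z) (y \<otimes>\<^bsub>V\<^esub> z)) =
        (prod_wedge3 (triples x y y) \<otimes>\<^bsub>U\<^esub> prod_wedge3 (triples x z z)) \<otimes>\<^bsub>U\<^esub>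
        prod_wedge3 (x \<times> y \<times> z)"
      \<comment> \<open>Expanding both slots yields four terms; the two mixed ones are exactly those
        that \<open>prod_wedge3_Times\<close> gives for the box.\<close>
      using xyz by (simp add: closed mid right prod_wedge3_Times U.m_ac)
  next
    fix x
    have "triples x \<one>\<^bsub>V\<^esub> \<one>\<^bsub>V\<^esub> = {}"
      by (simp add: triples_def one_V)
    then show "prod_wedge3 (triples x \<one>\<^bsub>V\<^esub> \<one>\<^bsub>V\<^esub>) = \<one>\<^bsub>U\<^esub>"
      by simp
  qed (simp_all only: V_elementary U_elementary closed T_closed left alternating prod_wedge3_rotate)
  then show ?thesis by (simp add: triples_def)
qed

theorem theorem1:
  shows "variety_E loop_F"
proof -
  \<comment> \<open>The cocycle conditions in a direct product hold componentwise, so the three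
    components are verified separately.\<close>
  have "moufang_cocycle V Z central_factor"
    unfolding Z_def central_factor_def
    by (intro moufang_cocycle_DirProd moufang_cocycle_bar moufang_cocycle_wedge2
        moufang_cocycle_wedge3)
  then have "variety_E (central_extension V Z central_factor)"
    by (rule moufang_cocycle.variety_E_E)
  \<comment> \<open>\<open>central_extension\<close> brackets the product exactly as
    \<open>loop_F\<close> does, so unfolding identifies the two loops.\<close>
  then show ?thesis
    by (simp add: loop_F_def central_extension_def)
qed

end
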